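(* Let $B\subset\mathbb{R}^n$ be a maximal lattice-free simplicial polytope. For $f\in\operatorname{int}(B)$ let $\bar R(f)$ be the lifting region. Then $\operatorname{vol}_{\mathbb{T}^n}(\bar R(f)/\mathbb{Z}^n)$ is an affine function of the coordinates of $f\in\operatorname{int}(B)$.
   Context: A lattice-free convex set in $\mathbb{R}^n$ is a convex set containing no point of $\mathbb{Z}^n$ in its interior; it is maximal if it is not properly contained in another one. A (full-dimensional) polytope is simplicial if every facet is a simplex. $\mathbb{T}^n=\mathbb{R}^n/\mathbb{Z}^n$ is the torus with its natural Lebesgue measure $\operatorname{vol}_{\mathbb{T}^n}$ of total mass $1$; for $X\subseteq\mathbb{R}^n$, $X/\mathbb{Z}^n$ denotes the image of $X$ in $\mathbb{T}^n$. Lifting region: for $f\in\operatorname{int}(B)$ write uniquely $B=\{x : a^i\cdot(x-f)\le 1,\ i\in I\}$ with $I$ finite and every inequality facet-defining, and let $\psi(r)=\max_{i\in I}a^i\cdot r$. A lifting of $\psi$ is a function $\pi:\mathbb{R}^n\to\mathbb{R}_+$ with $\pi\le\psi$ such that $\sum_r\pi(r)s_r\ge 1$ for every finitely supported $s:\mathbb{R}^n\to\mathbb{Z}_+$ with $f+\sum_r r s_r\in\mathbb{Z}^n$. The lifting region $\bar R(f)$ is the set of $r\in\mathbb{R}^n$ such that $\pi(r)=\psi(r)$ for every lifting $\pi$ of $\psi$. Known explicit description (Basu, Campelo, Conforti, Cornuéjols, Zambelli), which may be taken as the definition of $\bar R(f)$ for simplicial $B$: for $i\in I$ let $v^{i1},\ldots,v^{in}$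 be the vertices of the facet of $B$ defined by $a^i\cdot(x-f)\le 1$, and let $y^{ik}$, $k\in K_i$, be all the integer points on this facet. Let $C_i$ be the simplicial cone generated by $v^{ij}-f$, $j=1,\ldots,n$, and $R_{ik}=(f+C_i)\cap(y^{ik}-C_i)$. With $R(f)=\bigcup_{i\in I}\bigcup_{k\in K_i}R_{ik}$, one has $\bar R(f)=R(f)-f$. *)

theory Defs
  imports "HOL-Analysis.Analysis"
begin

definition integer_lattice :: "(real^'n) set" where
  "integer_lattice = {z. \<forall>i. z $ i \<in> \<int>}"

definition lattice_free :: "(real^'n) set \<Rightarrow> bool" where
  "lattice_free K \<longleftrightarrow> convex K \<and> interior K \<inter> integer_lattice = {}"

definition maximal_lattice_free :: "(real^'n) set \<Rightarrow> bool" where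
  "maximal_lattice_free B \<longleftrightarrow> lattice_free B \<and> (\<forall>K. lattice_free K \<longrightarrow> \<not> B \<subset> K)"

definition simplicial_polytope :: "(real^'n) set \<Rightarrow> bool" where
  "simplicial_polytope B \<longleftrightarrow>
     polytope B \<and> interior B \<noteq> {} \<and> (\<forall>F. F facet_of B \<longrightarrow> (\<exists>k. k simplex F))"

definition facet_cone :: "real^'n \<Rightarrow> (real^'n) set \<Rightarrow> (real^'n) set" where
  "facet_cone f F = convex_cone hull {v - f | v. v extreme_point_of F}"

definition spindle :: "real^'n \<Rightarrow> (real^'n) set \<Rightarrow> real^'n \<Rightarrow> (real^'n) set" where
  "spindle f F y = (\<lambda>c. f + c) ` facet_cone f F \<inter> (\<lambda>c. y - c) ` facet_cone f F"

(* For simplicial B and f in its interior this is the set on which every lifting of the gauge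
   function psi of B - f agrees with psi, by a theorem of Basu, Campelo, Conforti, Cornuejols and
   Zambelli. The facet-defining inequalities a^i . (x - f) <= 1 of B are indexed by the facets F,
   and y runs over all integer points of F, including those on its relative boundary. *)
definition lifting_region :: "(real^'n) set \<Rightarrow> real^'n \<Rightarrow> (real^'n) set" where
  "lifting_region B f =
     (\<lambda>x. x - f) ` (\<Union>F\<in>{F. F facet_of B}. \<Union>y\<in>F \<inter> integer_lattice. spindle f F y)"

definition torus_rel :: "((real^'n) \<times> (real^'n)) set" where
  "torus_rel = {(x, y). x - y \<in> integer_lattice}"

definition torus_proj :: "real^'n \<Rightarrow> (real^'n) set" where
  "torus_proj x = torus_rel `` {x}"

definition unit_cell :: "(real^'n) set" where
  "unit_cell = {x. \<forall>i. 0 \<le> x $ i \<and> x $ i < 1}"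

(* Image of Lebesgue measure under the bijection from a fundamental cell to the quotient; a subset
   of the quotient is measurable iff its full preimage is Lebesgue measurable. *)
definition torus :: "(real^'n) set measure" where
  "torus = distr (restrict_space lebesgue unit_cell)
     (sigma (UNIV // torus_rel)
        {A. A \<subseteq> UNIV // torus_rel \<and> torus_proj -` A \<in> sets lebesgue})
     torus_proj"

lemma equiv_torus_rel: "equiv UNIV (torus_rel :: ((real^'n) \<times> (real^'n)) set)"
proof (rule equivI)
  show "refl (torus_rel :: ((real^'n) \<times> (real^'n)) set)"
    by (auto simp: refl_on_def torus_rel_def integer_lattice_def)
  show "sym (torus_rel :: ((real^'n) \<times> (real^'n)) set)"
  proof (rule symI)
    fix x y :: "real^'n" assume "(x, y) \<in> torus_rel"
    then have "x $ i - y $ i \<in> \<int>" for i by (auto simp: torus_rel_def integer_lattice_def)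
    then have "- (x $ i - y $ i) \<in> \<int>" for i using Ints_minus by blast
    then show "(y, x) \<in> torus_rel" by (auto simp: torus_rel_def integer_lattice_def)
  qed
  show "trans (torus_rel :: ((real^'n) \<times> (real^'n)) set)"
  proof (rule transI)
    fix x y z :: "real^'n" assume "(x, y) \<in> torus_rel" "(y, z) \<in> torus_rel"
    then have "(x $ i - y $ i) + (y $ i - z $ i) \<in> \<int>" for i
      by (intro Ints_add) (auto simp: torus_rel_def integer_lattice_def)
    then show "(x, z) \<in> torus_rel" by (auto simp: torus_rel_def integer_lattice_def)
  qed
qed auto

lemma torus_proj_in_quotient: "torus_proj x \<in> UNIV // torus_rel"
  by (simp add: torus_proj_def quotientI)

lemma space_torus: "space torus = UNIV // torus_rel"
  by (simp add: torus_def space_measure_of_conv)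

lemma sets_torus:
  "sets (torus :: (real^'n) set measure) =
     {A. A \<subseteq> UNIV // torus_rel \<and> torus_proj -` A \<in> sets lebesgue}"
proof -
  have "sigma_algebra (UNIV // (torus_rel :: ((real^'n) \<times> (real^'n)) set))
      {A. A \<subseteq> UNIV // torus_rel \<and> torus_proj -` A \<in> sets lebesgue}"
  proof (subst sigma_algebra_iff2, intro conjI ballI allI impI)
    fix A assume "A \<in> {A. A \<subseteq> UNIV // (torus_rel :: ((real^'n) \<times> (real^'n)) set)
        \<and> torus_proj -` A \<in> sets lebesgue}"
    moreover have "torus_proj -` (UNIV // torus_rel - A) = UNIV - torus_proj -` A"
      by (auto simp: torus_proj_in_quotient)
    ultimately show "UNIV // torus_rel - A \<in> {A. A \<subseteq> UNIV // torus_rel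
        \<and> torus_proj -` A \<in> sets lebesgue}"
      using sets.compl_sets[of "torus_proj -` A" lebesgue] by auto
  qed (auto simp: vimage_UN)
  then show ?thesis
    by (simp only: torus_def sets_distr sigma_algebra.sets_measure_of_eq)
qed

lemma unit_cell_lebesgue:
  "(unit_cell :: (real^'n) set) \<in> sets lebesgue"
  "emeasure lebesgue (unit_cell :: (real^'n) set) = 1"
proof -
  have sub: "box 0 1 \<subseteq> (unit_cell :: (real^'n) set)" "unit_cell \<subseteq> (cbox 0 1 :: (real^'n) set)"
    by (auto simp: unit_cell_def mem_box_cart less_imp_le)
  have neg: "negligible ((cbox 0 (1::real^'n) - unit_cell) \<union> (unit_cell - cbox 0 1))"
    by (rule negligible_subset[OF negligible_frontier_interval[of 0 1]]) (use sub in auto)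
  have lm: "(unit_cell :: (real^'n) set) \<in> lmeasurable"
    by (rule lmeasurable_negligible_symdiff[OF lmeasurable_cbox neg])
  then show "(unit_cell :: (real^'n) set) \<in> sets lebesgue" by (rule fmeasurableD)
  have "box 0 (1::real^'n) \<noteq> {}" by (simp add: interval_ne_empty_cart)
  then have "measure lebesgue (cbox 0 (1::real^'n)) = 1"
    by (simp add: content_cbox_if_cart interval_ne_empty_cart)
  then have "measure lebesgue (unit_cell :: (real^'n) set) = 1"
    using measure_negligible_symdiff[OF lmeasurable_cbox neg] by metis
  then show "emeasure lebesgue (unit_cell :: (real^'n) set) = 1"
    using emeasure_eq_measure2[OF lm] by (metis ennreal_1)
qed

lemma torus_proj_measurable: "torus_proj \<in> measurable (restrict_space lebesgue unit_cell) torus"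
proof -
  have "torus_proj -` A \<inter> unit_cell \<in> sets (restrict_space lebesgue unit_cell)"
    if "A \<in> sets torus" for A :: "(real^'n) set set"
    using that by (auto simp: sets_torus sets_restrict_space)
  then show ?thesis
    by (auto simp: measurable_def space_restrict_space space_torus torus_proj_in_quotient)
qed

lemma emeasure_torus:
  assumes "A \<in> sets torus"
  shows "emeasure torus A = emeasure lebesgue (torus_proj -` A \<inter> unit_cell)"
proof -
  have "emeasure torus A = emeasure (restrict_space lebesgue unit_cell) (torus_proj -` A \<inter> unit_cell)"
    using emeasure_distr[OF torus_proj_measurable[unfolded torus_def measurable_distr_eq2]] assms
    by (simp only: torus_def sets_distr space_restrict_space space_completion space_lborel space_borel
        Int_UNIV_right Int_UNIV_left)
  also have "\<dots> = emeasure lebesgue (torus_proj -` A \<inter> unit_cell)"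
    by (intro emeasure_restrict_space) (auto simp: unit_cell_lebesgue)
  finally show ?thesis .
qed

lemma emeasure_torus_space: "emeasure torus (space (torus :: (real^'n) set measure)) = 1"
proof -
  have "torus_proj -` space torus \<inter> unit_cell = (unit_cell :: (real^'n) set)"
    by (auto simp: space_torus torus_proj_in_quotient)
  with emeasure_torus[OF sets.top]
  have "emeasure torus (space (torus :: (real^'n) set measure)) = emeasure lebesgue (unit_cell :: (real^'n) set)"
    by metis
  also have "\<dots> = 1" by (rule unit_cell_lebesgue(2))
  finally show ?thesis .
qed

end

theory Submission
  imports Defs
begin

text \<open>For a facet \<open>F\<close> on the hyperplane \<open>a \<bullet> x = b\<close> and two interior points \<open>g\<close>, \<open>f\<close>, the affine map
  \<open>x \<mapsto> x + ((b - a \<bullet> x) / (b - a \<bullet> g)) (f - g)\<close> fixes \<open>F\<close> pointwise, takes the spindles over \<open>F\<close>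
  with apex \<open>g\<close> to those with apex \<open>f\<close>, commutes with translations parallel to \<open>F\<close>, and has
  determinant \<open>(b - a \<bullet> f) / (b - a \<bullet> g)\<close>, which is affine in \<open>f\<close>. Lattice-freeness forces interior
  points of two spindles that agree modulo the integer lattice to lie in spindles over the same
  facet and to differ by a vector parallel to it. So a transversal modulo the parallel lattice
  vectors, chosen for \<open>g\<close> and transported to \<open>f\<close>, injects into the torus, and its volume scales by
  the determinant; summing over the facets gives an affine function.\<close>

subsection \<open>Measure on the torus\<close>

lemma integer_lattice_add: "x \<in> integer_lattice \<Longrightarrow> y \<in> integer_lattice \<Longrightarrow> x + y \<in> integer_lattice"
  by (auto simp: integer_lattice_def)

lemma integer_lattice_diff: "x \<in> integer_lattice \<Longrightarrow> y \<in> integer_lattice \<Longrightarrow> x - y \<in> integer_lattice"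
  by (auto simp: integer_lattice_def)

lemma integer_lattice_0: "0 \<in> integer_lattice"
  by (auto simp: integer_lattice_def)

lemma integer_lattice_minus: "x \<in> integer_lattice \<Longrightarrow> - x \<in> integer_lattice"
  by (auto simp: integer_lattice_def)

lemma countable_integer_lattice: "countable (integer_lattice :: (real^'n) set)"
proof -
  have "integer_lattice \<subseteq> range (\<lambda>g :: 'n \<Rightarrow> int. (\<chi> i. of_int (g i)) :: real^'n)"
  proof
    fix x :: "real^'n" assume "x \<in> integer_lattice"
    then have "x = (\<chi> i. of_int \<lfloor>x $ i\<rfloor>)"
      by (auto simp: integer_lattice_def vec_eq_iff)
    then show "x \<in> range (\<lambda>g :: 'n \<Rightarrow> int. (\<chi> i. of_int (g i)) :: real^'n)" by (rule range_eqI[where x = "\<lambda>i. \<lfloor>x $ i\<rfloor>"])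
  qed
  then show ?thesis
    using countable_subset uncountable_def countableI_type countable_image by metis
qed

lemma torus_proj_eq_iff: "torus_proj x = torus_proj y \<longleftrightarrow> x - y \<in> integer_lattice"
  unfolding torus_proj_def
  by (subst eq_equiv_class_iff[OF equiv_torus_rel]) (auto simp: torus_rel_def)

lemma unit_cell_shift:
  obtains z where "z \<in> integer_lattice" "x - z \<in> unit_cell"
proof
  show "(\<chi> i. of_int \<lfloor>x $ i\<rfloor>) \<in> integer_lattice" by (auto simp: integer_lattice_def)
  show "x - (\<chi> i. of_int \<lfloor>x $ i\<rfloor>) \<in> unit_cell"
    by (auto simp: unit_cell_def algebra_simps) (use real_of_int_floor_add_one_gt in \<open>simp add: add.commute\<close>)
qed

lemma unit_cell_inj:
  assumes "x \<in> unit_cell" "y \<in> unit_cell" "x - y \<in> integer_lattice"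
  shows "x = y"
proof -
  have "x $ i = y $ i" for i
  proof -
    have "\<bar>x $ i - y $ i\<bar> < 1"
      using assms(1,2) unfolding unit_cell_def by (smt (verit) mem_Collect_eq)
    moreover have "x $ i - y $ i \<in> \<int>"
      using assms(3) by (auto simp: integer_lattice_def)
    ultimately show ?thesis
      by (metis Ints_nonzero_abs_less1 eq_iff_diff_eq_0)
  qed
  then show ?thesis by (simp add: vec_eq_iff)
qed

lemma mem_translation_iff: "x \<in> (+) z ` S \<longleftrightarrow> x - z \<in> S" for x :: "'a::ab_group_add"
  by (auto intro: image_eqI[of _ _ "x - z"])

lemma vimage_torus_proj_image:
  "torus_proj -` torus_proj ` X = (\<Union>z\<in>integer_lattice. (+) z ` X)"
proof (intro set_eqI iffI)
  fix x assume "x \<in> torus_proj -` torus_proj ` X"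
  then obtain y where y: "y \<in> X" "x - y \<in> integer_lattice"
    by (auto simp: torus_proj_eq_iff)
  then show "x \<in> (\<Union>z\<in>integer_lattice. (+) z ` X)"
    by (intro UN_I[of "x - y"]) (auto simp: mem_translation_iff)
next
  fix x assume "x \<in> (\<Union>z\<in>integer_lattice. (+) z ` X)"
  then obtain z where "z \<in> integer_lattice" "x - z \<in> X"
    by (auto simp: mem_translation_iff simp del: image_add_0)
  then show "x \<in> torus_proj -` torus_proj ` X"
    using torus_proj_eq_iff[of x "x - z"] by auto
qed

lemma emeasure_lebesgue_translation:
  "emeasure lebesgue ((+) a ` S) = emeasure lebesgue (S :: 'a::euclidean_space set)"
  using emeasure_lebesgue_affine[of 1 a S] by (simp add: ac_simps cong: image_cong_simp)

lemma lebesgue_translation: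
  "S \<in> sets lebesgue \<Longrightarrow> (+) a ` S \<in> sets lebesgue" for S :: "'a::euclidean_space set"
  using lebesgue_sets_translation[of S a] by simp

lemma torus_proj_image_sets:
  assumes "X \<in> sets lebesgue"
  shows "torus_proj ` X \<in> sets torus"
  unfolding sets_torus vimage_torus_proj_image mem_Collect_eq
  using assms countable_integer_lattice
  by (auto intro!: sets.countable_UN' lebesgue_translation simp: torus_proj_in_quotient)

text \<open>Cut \<open>E\<close> along the lattice translates of the unit cell and move every piece
  back into the cell. The moved pieces make up the preimage that \<open>emeasure_torus\<close>
  measures, and translation preserves the measure of each of the countably many pieces.\<close>

lemma emeasure_torus_proj_inj:
  fixes E :: "(real^'n) set"
  assumes "E \<in> sets lebesgue" "inj_on torus_proj E"
  shows "emeasure torus (torus_proj ` E) = emeasure lebesgue E"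
proof -
  define P where "P z = E \<inter> (+) z ` unit_cell" for z :: "real^'n"
  have meas: "P z \<in> sets lebesgue" for z
    unfolding P_def by (intro sets.Int assms lebesgue_translation unit_cell_lebesgue)
  have P_iff: "x \<in> P z \<longleftrightarrow> x \<in> E \<and> x - z \<in> unit_cell" for x z
    by (simp add: P_def mem_translation_iff)
  have E: "E = (\<Union>z\<in>integer_lattice. P z)"
  proof (intro equalityI subsetI)
    fix x assume "x \<in> E"
    moreover obtain z where "z \<in> integer_lattice" "x - z \<in> unit_cell" by (rule unit_cell_shift)
    ultimately show "x \<in> (\<Union>z\<in>integer_lattice. P z)" by (auto simp: P_iff)
  qed (auto simp: P_iff)
  have disjP: "disjoint_family_on P integer_lattice"
    unfolding disjoint_family_on_def
  proof (intro ballI impI)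
    fix z w :: "real^'n" assume zw: "z \<in> integer_lattice" "w \<in> integer_lattice" "z \<noteq> w"
    have False if "x \<in> P z \<inter> P w" for x
      using unit_cell_inj[of "x - z" "x - w"] that zw integer_lattice_diff[of w z]
      by (simp add: P_iff)
    then show "P z \<inter> P w = {}" by blast
  qed
  have pre: "torus_proj -` torus_proj ` E \<inter> unit_cell = (\<Union>z\<in>integer_lattice. (+) (-z) ` P z)"
  proof (intro set_eqI iffI)
    fix x assume "x \<in> torus_proj -` torus_proj ` E \<inter> unit_cell"
    then obtain y z where y: "y \<in> E" "z \<in> integer_lattice" "x = z + y" "x \<in> unit_cell"
      unfolding vimage_torus_proj_image by auto
    then have "y \<in> P (-z)" by (simp add: P_iff add.commute)
    with y show "x \<in> (\<Union>z\<in>integer_lattice. (+) (-z) ` P z)"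
      using integer_lattice_minus[of z] by (intro UN_I[of "-z"]) auto
  next
    fix x assume "x \<in> (\<Union>z\<in>integer_lattice. (+) (-z) ` P z)"
    then obtain z y where "z \<in> integer_lattice" "y \<in> E" "y - z \<in> unit_cell" "x = - z + y"
      by (auto simp: P_iff)
    then show "x \<in> torus_proj -` torus_proj ` E \<inter> unit_cell"
      unfolding vimage_torus_proj_image using integer_lattice_minus[of z]
      by (intro IntI UN_I[of "-z"] image_eqI[of _ _ y]) auto
  qed
  \<comment> \<open>Injectivity enters here: if two moved pieces met, two distinct points of
    \<open>E\<close> would agree modulo the lattice.\<close>
  have disjQ: "disjoint_family_on (\<lambda>z. (+) (-z) ` P z) integer_lattice"
    unfolding disjoint_family_on_def
  proof (intro ballI impI)
    fix z w :: "real^'n" assume zw: "z \<in> integer_lattice" "w \<in> integer_lattice" "z \<noteq> w"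
    have False if "x \<in> (+) (-z) ` P z" "x \<in> (+) (-w) ` P w" for x
    proof -
      have "x + z \<in> E" "x + w \<in> E" using that[unfolded mem_translation_iff] by (simp_all add: P_iff)
      moreover have "torus_proj (x + z) = torus_proj (x + w)"
        using zw integer_lattice_diff[of z w] by (simp add: torus_proj_eq_iff)
      ultimately have "x + z = x + w" using inj_onD[OF assms(2)] by blast
      with zw show False by simp
    qed
    then show "(+) (-z) ` P z \<inter> (+) (-w) ` P w = {}" by blast
  qed
  have "emeasure torus (torus_proj ` E)
      = emeasure lebesgue (\<Union>z\<in>integer_lattice. (+) (-z) ` P z)"
    using emeasure_torus[OF torus_proj_image_sets[OF assms(1)]] pre by simp
  also have "\<dots> = (\<integral>\<^sup>+z. emeasure lebesgue ((+) (-z) ` P z) \<partial>count_space integer_lattice)"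
    by (intro emeasure_UN_countable lebesgue_translation meas countable_integer_lattice disjQ)
  also have "\<dots> = (\<integral>\<^sup>+z. emeasure lebesgue (P z) \<partial>count_space integer_lattice)"
    by (simp only: emeasure_lebesgue_translation)
  also have "\<dots> = emeasure lebesgue (\<Union>z\<in>integer_lattice. P z)"
    by (intro emeasure_UN_countable[symmetric] meas countable_integer_lattice disjP)
  also have "\<dots> = emeasure lebesgue E"
    by (simp only: E[symmetric])
  finally show ?thesis .
qed

text \<open>The torus has total mass 1, which bounds the measure of \<open>E\<close>.\<close>

lemma lmeasurable_if_inj_on_torus_proj:
  fixes E :: "(real^'n) set"
  assumes "E \<in> sets lebesgue" "inj_on torus_proj E"
  shows "E \<in> lmeasurable"
proof -
  have "emeasure torus (torus_proj ` E) \<le> emeasure torus (space (torus :: (real^'n) set measure))"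
    by (rule emeasure_space)
  then have "emeasure lebesgue E \<le> 1"
    using emeasure_torus_proj_inj[OF assms] emeasure_torus_space by metis
  then have "emeasure lebesgue E < \<infinity>"
    by (rule le_less_trans) simp
  with assms(1) show ?thesis by (auto simp: fmeasurable_def)
qed

text \<open>Outside \<open>N\<close> the set \<open>X\<close> has the same image as
  \<open>E\<close>. The preimage of the image of \<open>N \<inter> X\<close> is a countable union of
  translates of a null set, so it contributes nothing.\<close>

lemma measure_torus_proj_transversal:
  fixes E X N :: "(real^'n) set"
  assumes E: "E \<in> sets lebesgue" "inj_on torus_proj E" "E \<subseteq> X"
    and N: "negligible N"
    and cover: "\<And>x. x \<in> X \<Longrightarrow> x \<in> N \<or> (\<exists>e\<in>E. x - e \<in> integer_lattice)"
  shows "measure torus (torus_proj ` X) = measure lebesgue E"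
proof -
  have NX: "negligible (N \<inter> X)" using N by (rule negligible_subset) auto
  then have NXm: "N \<inter> X \<in> sets lebesgue" by (simp add: negligible_iff_null_sets null_setsD2)
  have img: "torus_proj ` X = torus_proj ` E \<union> torus_proj ` (N \<inter> X)"
  proof (intro equalityI subsetI)
    fix p assume "p \<in> torus_proj ` X"
    then obtain x where "x \<in> X" "p = torus_proj x" by blast
    then show "p \<in> torus_proj ` E \<union> torus_proj ` (N \<inter> X)"
      using cover[of x] torus_proj_eq_iff[of x] by blast
  qed (use E(3) in blast)
  have "negligible (\<Union>z\<in>integer_lattice. (+) z ` (N \<inter> X))"
    using countable_integer_lattice by (intro negligible_countable_Union) (auto intro: negligible_translation NX)
  then have "negligible (torus_proj -` torus_proj ` (N \<inter> X) \<inter> unit_cell)"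
    unfolding vimage_torus_proj_image by (rule negligible_subset) auto
  then have "emeasure torus (torus_proj ` (N \<inter> X)) = 0"
    using emeasure_torus[OF torus_proj_image_sets[OF NXm]] by (simp add: negligible_iff_null_sets null_setsD1)
  then have "emeasure torus (torus_proj ` X) = emeasure torus (torus_proj ` E)"
    unfolding img using torus_proj_image_sets[OF NXm] torus_proj_image_sets[OF E(1)]
    by (intro emeasure_Un_null_set) auto
  then show ?thesis
    using emeasure_torus_proj_inj[OF E(1,2)] by (simp add: measure_def)
qed

text \<open>Number the lattice translates of the unit cell and keep, in each class modulo
  \<open>L\<close>, the point in the first cell that the class meets inside \<open>V\<close>. Two
  points of one cell never differ by a nonzero lattice vector, so the choice is unique; it uses
  countable set operations only, so it is measurable.\<close>

lemma measurable_transversal: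
  fixes V L :: "(real^'n) set"
  assumes V: "V \<in> sets lebesgue" and L: "L \<subseteq> integer_lattice"
    and L0: "0 \<in> L" and Lm: "\<And>z. z \<in> L \<Longrightarrow> -z \<in> L" and La: "\<And>z w. z \<in> L \<Longrightarrow> w \<in> L \<Longrightarrow> z + w \<in> L"
  obtains D where "D \<subseteq> V" "D \<in> sets lebesgue" "\<forall>x\<in>V. \<exists>d\<in>D. x - d \<in> L"
    "\<forall>d\<in>D. \<forall>d'\<in>D. d - d' \<in> L \<longrightarrow> d = d'"
proof
  define e where "e = to_nat_on (integer_lattice :: (real^'n) set)"
  have einj: "e z = e w \<Longrightarrow> z = w" if "z \<in> integer_lattice" "w \<in> integer_lattice" for z w
    using that inj_on_to_nat_on[OF countable_integer_lattice] by (auto simp: e_def inj_on_def)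
  define P where "P z = V \<inter> (+) z ` unit_cell" for z :: "real^'n"
  have Pm: "P z \<in> sets lebesgue" for z
    unfolding P_def by (intro sets.Int V lebesgue_translation unit_cell_lebesgue)
  have P_iff: "x \<in> P z \<longleftrightarrow> x \<in> V \<and> x - z \<in> unit_cell" for x z
    by (simp add: P_def mem_translation_iff)
  \<comment> \<open>From the piece in cell \<open>z\<close> remove all points congruent modulo
    \<open>L\<close> to a point of a piece with a smaller number.\<close>
  define D where "D = (\<Union>z\<in>integer_lattice. P z -
     (\<Union>h\<in>{h\<in>integer_lattice. e h < e z}. \<Union>w\<in>L. (+) w ` P h))"
  have cL: "countable L" using L countable_integer_lattice countable_subset by blast
  show "D \<subseteq> V" by (auto simp: D_def P_iff)
  show "D \<in> sets lebesgue"
    unfolding D_def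
    by (intro sets.countable_UN' sets.Diff Pm countable_integer_lattice cL image_subsetI lebesgue_translation
         countable_subset[OF _ countable_integer_lattice]) auto
  show "\<forall>x\<in>V. \<exists>d\<in>D. x - d \<in> L"
  proof
    fix x assume x: "x \<in> V"
    \<comment> \<open>\<open>Q n\<close> says that the class of \<open>x\<close> meets
      \<open>V\<close> in the cell numbered \<open>n\<close>; the least such \<open>n\<close> yields
      the representative.\<close>
    define Q where "Q n \<longleftrightarrow> (\<exists>z\<in>integer_lattice. e z = n \<and> (\<exists>w\<in>L. x + w \<in> P z))" for n
    obtain z0 where "z0 \<in> integer_lattice" "x - z0 \<in> unit_cell" using unit_cell_shift by blast
    then have "x + 0 \<in> P z0" using x by (simp add: P_iff)
    with \<open>z0 \<in> integer_lattice\<close> L0 have "Q (e z0)" unfolding Q_def by blast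
    then have "Q (LEAST n. Q n)" by (rule LeastI)
    then obtain z w where zw: "z \<in> integer_lattice" "e z = (LEAST n. Q n)" "w \<in> L" "x + w \<in> P z"
      unfolding Q_def by blast
    have "x + w \<notin> (+) w' ` P h" if h: "h \<in> integer_lattice" "e h < e z" "w' \<in> L" for h w'
    proof
      assume "x + w \<in> (+) w' ` P h"
      then have "x + (w - w') \<in> P h" by (auto simp: algebra_simps)
      moreover have "w - w' \<in> L" using La[OF zw(3) Lm[OF h(3)]] by simp
      ultimately have "Q (e h)" unfolding Q_def using h by blast
      then show False using h(2) zw(2) not_less_Least by metis
    qed
    then have "x + w \<in> D" using zw unfolding D_def by blast
    moreover have "x - (x + w) \<in> L" using Lm[OF zw(3)] by simp
    ultimately show "\<exists>d\<in>D. x - d \<in> L" by blast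
  qed
  show "\<forall>d\<in>D. \<forall>d'\<in>D. d - d' \<in> L \<longrightarrow> d = d'"
  proof (intro ballI impI)
    fix d d' assume dd: "d \<in> D" "d' \<in> D" "d - d' \<in> L"
    obtain z where z: "z \<in> integer_lattice" "d \<in> P z"
       "\<And>h w. h \<in> integer_lattice \<Longrightarrow> e h < e z \<Longrightarrow> w \<in> L \<Longrightarrow> d \<notin> (+) w ` P h"
      using dd(1) unfolding D_def by blast
    obtain z' where z': "z' \<in> integer_lattice" "d' \<in> P z'"
       "\<And>h w. h \<in> integer_lattice \<Longrightarrow> e h < e z' \<Longrightarrow> w \<in> L \<Longrightarrow> d' \<notin> (+) w ` P h"
      using dd(2) unfolding D_def by blast
    \<comment> \<open>Each of the two points lies in an \<open>L\<close>-translate of the other's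
      piece, so neither cell number can be the smaller one.\<close>
    have "d = (d - d') + d'" "d' = -(d - d') + d" by auto
    then have "d \<in> (+) (d - d') ` P z'" "d' \<in> (+) (-(d - d')) ` P z"
      using z(2) z'(2) by blast+
    then have "e z = e z'"
      using z(3)[OF z'(1) _ dd(3)] z'(3)[OF z(1) _ Lm[OF dd(3)]] by (meson nat_neq_iff)
    then have "z = z'" using einj z(1) z'(1) by blast
    then have "d - z = d' - z"
      using unit_cell_inj[of "d - z" "d' - z"] z(2) z'(2) dd(3) L by (auto simp: P_iff)
    then show "d = d'" by simp
  qed
qed

subsection \<open>Shears fixing a hyperplane\<close>

lemma linear_rank_one_update:
  fixes a u :: "'a::real_inner"
  shows "linear (\<lambda>r. r + (a \<bullet> r) *\<^sub>R u)"
  by (rule linearI) (auto simp: algebra_simps inner_simps)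

text \<open>An orthogonal map \<open>q\<close> carries a multiple of a coordinate axis to
  \<open>a\<close>. Conjugation by \<open>q\<close> keeps the determinant and leaves a map that
  differs from the identity in column \<open>k\<close> only.\<close>

lemma det_rank_one_update:
  fixes a u :: "real^'n"
  shows "det (matrix (\<lambda>r. r + (a \<bullet> r) *\<^sub>R u)) = 1 + a \<bullet> u"
proof -
  fix k :: 'n
  have "norm (norm a *\<^sub>R axis k (1::real)) = norm a" by simp
  then obtain q :: "real^'n \<Rightarrow> real^'n" where q: "orthogonal_transformation q" "q (norm a *\<^sub>R axis k 1) = a"
    by (rule orthogonal_transformation_exists)
  have linq: "linear q" using q(1) by (simp add: orthogonal_transformation_linear)
  obtain v where v: "q v = u"
    using surjD[OF orthogonal_transformation_surj[OF q(1)]] by metis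
  have aq: "a \<bullet> q r = norm a * r $ k" for r
  proof -
    have "q (norm a *\<^sub>R axis k 1) \<bullet> q r = (norm a *\<^sub>R axis k 1) \<bullet> r"
      using q(1) by (simp only: orthogonal_transformation_def)
    then show ?thesis by (simp only: q(2)) (simp add: inner_axis')
  qed
  define g where "g r = r + (norm a * r $ k) *\<^sub>R v" for r
  have ling: "linear g"
    by (rule linearI) (auto simp: g_def algebra_simps)
  have comm: "(\<lambda>r. r + (a \<bullet> r) *\<^sub>R u) \<circ> q = q \<circ> g"
    by (rule ext) (simp add: g_def aq linear_add[OF linq] linear_scale[OF linq] v)
  have "matrix (\<lambda>r. r + (a \<bullet> r) *\<^sub>R u) ** matrix q = matrix q ** matrix g"
    unfolding matrix_compose[OF linq linear_rank_one_update, symmetric]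
      matrix_compose[OF ling linq, symmetric] comm ..
  then have "det (matrix (\<lambda>r. r + (a \<bullet> r) *\<^sub>R u)) * det (matrix q) = det (matrix q) * det (matrix g)"
    unfolding det_mul[symmetric] by (rule arg_cong)
  moreover have "det (matrix q) \<noteq> 0"
    using det_orthogonal_matrix[of "matrix q"] q(1) by (auto simp: orthogonal_transformation_matrix)
  ultimately have "det (matrix (\<lambda>r. r + (a \<bullet> r) *\<^sub>R u)) = det (matrix g)" by simp
  \<comment> \<open>Column \<open>k\<close> is written as a product with \<open>mat 1\<close> to
    match \<open>cramer_lemma\<close>, which evaluates the determinant as the \<open>k\<close>-th
    entry of the multiplied vector.\<close>
  also have "matrix g = (\<chi> i j. if j = k then (mat 1 *v (axis k 1 + norm a *\<^sub>R v)) $ i else (mat 1 :: real^'n^'n) $ i $ j)"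
    by (simp only: matrix_def g_def vec_eq_iff matrix_vector_mul_lid vec_lambda_beta vector_add_component
         vector_scaleR_component) (simp add: axis_def mat_def)
  also have "det \<dots> = 1 + norm a * v $ k"
    by (simp only: cramer_lemma det_I) simp
  also have "\<dots> = 1 + a \<bullet> u" using aq[of v] v by simp
  finally show ?thesis .
qed

text \<open>The library version requires the index type to be well-ordered.\<close>

lemma
  fixes f :: "real^'n \<Rightarrow> real^'n"
  assumes f: "linear f" and S: "S \<in> lmeasurable"
  shows lmeasurable_linear_image_cart: "f ` S \<in> lmeasurable"
    and measure_linear_image_cart: "measure lebesgue (f ` S) = \<bar>det (matrix f)\<bar> * measure lebesgue S"
proof -
  define P where "P f \<longleftrightarrow> (\<forall>S. S \<in> lmeasurable \<longrightarrow> f ` S \<in> lmeasurable \<and>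
      measure lebesgue (f ` S) = \<bar>det (matrix f)\<bar> * measure lebesgue S)" for f :: "real^'n \<Rightarrow> real^'n"
  \<comment> \<open>For the coordinate swap and the elementary shear it suffices to compare volumes
    on boxes.\<close>
  have unimodular: "P h" if "linear h" "\<bar>det (matrix h)\<bar> = 1"
    "\<And>a b. cbox a b \<noteq> {} \<Longrightarrow> measure lebesgue (h ` cbox a b) = measure lebesgue (cbox a b)" for h
  proof -
    have box: "measure lebesgue (h ` cbox a b) = 1 * measure lebesgue (cbox a b)" for a b
      using that(3)[of a b] by (cases "cbox a b = {}") auto
    show ?thesis
      unfolding P_def
    proof (intro allI impI)
      fix S :: "(real^'n) set" assume "S \<in> lmeasurable"
      from measure_linear_sufficient[OF that(1) this box]
      show "h ` S \<in> lmeasurable \<and> measure lebesgue (h ` S) = \<bar>det (matrix h)\<bar> * measure lebesgue S"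
        unfolding that(2) by (elim conjE) (intro conjI, assumption, rule sym)
    qed
  qed
  have "P f"
  proof (rule induct_linear_elementary[where P = P, OF f])
    fix f g :: "real^'n \<Rightarrow> real^'n" assume fg: "linear f" "linear g" "P f" "P g"
    have "(f \<circ> g) ` S = f ` g ` S" for S by auto
    moreover have "det (matrix (f \<circ> g)) = det (matrix f) * det (matrix g)"
      by (simp add: matrix_compose[OF fg(2,1)] det_mul)
    ultimately show "P (f \<circ> g)"
      using fg(3,4) by (simp only: P_def) (simp add: abs_mult)
  next
    fix f :: "real^'n \<Rightarrow> real^'n" and i assume f: "linear f" and 0: "\<And>x. f x $ i = 0"
    have "\<not> inj f"
      using linear_injective_imp_surjective[OF f] 0 by (metis surjD vec_component zero_neq_one)
    then show "P f"
      using negligible_linear_singular_image[OF f] det_nz_iff_inj[OF f]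
      by (auto simp: P_def negligible_iff_measure)
  next
    fix c :: "'n \<Rightarrow> real"
    show "P (\<lambda>x. \<chi> i. c i * x $ i)"
      by (simp add: P_def measurable_stretch measure_stretch matrix_def axis_def det_diagonal)
  next
    fix m n :: 'n assume "m \<noteq> n"
    define h where "h x = (\<chi> i. x $ Transposition.transpose m n i)" for x :: "real^'n"
    have h: "linear h" by (rule linearI) (auto simp: h_def vec_eq_iff)
    have inv: "h (h x) = x" for x by (simp add: h_def vec_eq_iff)
    \<comment> \<open>The swap is an involution, so its determinant squares to 1.\<close>
    then have "matrix h ** matrix h = mat 1"
      using matrix_compose[OF h h] by (simp add: o_def matrix_id_mat_1[unfolded id_def])
    then have "det (matrix h) * det (matrix h) = 1"
      by (metis det_mul det_I)
    then have det: "\<bar>det (matrix h)\<bar> = 1"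
      by (auto simp: square_eq_1_iff)
    have box: "h ` cbox a b = cbox (h a) (h b)" for a b
    proof -
      have "x \<in> cbox (h a) (h b)" if "x \<in> h ` cbox a b" for a b x
        using that by (auto simp: h_def mem_box_cart)
      then have 1: "h ` cbox a b \<subseteq> cbox (h a) (h b)" for a b by blast
      have "h ` cbox (h a) (h b) \<subseteq> cbox a b"
        using 1[of "h a" "h b"] by (simp only: inv)
      then have "h ` h ` cbox (h a) (h b) \<subseteq> h ` cbox a b" by (rule image_mono)
      then have "cbox (h a) (h b) \<subseteq> h ` cbox a b" by (simp only: image_image inv image_ident)
      with 1 show ?thesis by (intro equalityI)
    qed
    have "P h"
    proof (rule unimodular[OF h det])
      fix a b :: "real^'n" assume ne: "cbox a b \<noteq> {}"
      then have "cbox (h a) (h b) \<noteq> {}" using box by (metis image_is_empty)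
      then have "measure lborel (cbox (h a) (h b)) = (\<Prod>i\<in>UNIV. b $ Transposition.transpose m n i - a $ Transposition.transpose m n i)"
        by (simp add: content_cbox_cart h_def)
      also have "\<dots> = (\<Prod>i\<in>UNIV. b $ i - a $ i)"
        by (rule prod.reindex_bij_betw[of "Transposition.transpose m n" UNIV UNIV "\<lambda>i. b $ i - a $ i"]) simp
      also have "\<dots> = measure lborel (cbox a b)" using ne by (simp add: content_cbox_cart)
      finally show "measure lebesgue (h ` cbox a b) = measure lebesgue (cbox a b)"
        by (simp add: box)
    qed
    then show "P (\<lambda>x. \<chi> i. x $ Transposition.transpose m n i)"
      by (simp add: h_def[abs_def])
  next
    fix m n :: 'n assume mn: "m \<noteq> n"
    define h where "h x = (\<chi> i. if i = m then x $ m + x $ n else x $ i)" for x :: "real^'n"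
    have h_eq: "h = (\<lambda>r. r + (axis n 1 \<bullet> r) *\<^sub>R axis m 1)"
      by (simp add: h_def fun_eq_iff vec_eq_iff inner_axis') (simp add: axis_def)
    have h: "linear h" unfolding h_eq by (rule linear_rank_one_update)
    have det: "\<bar>det (matrix h)\<bar> = 1"
      unfolding h_eq det_rank_one_update using mn by (simp add: inner_axis_axis)
    have "P h"
    proof (rule unimodular[OF h det])
      fix a b :: "real^'n" assume ne: "cbox a b \<noteq> {}"
      \<comment> \<open>The box is moved to have lower corner 0, the position in which
        \<open>measure_shear_interval\<close> is applied.\<close>
      have "cbox a b = (+) a ` cbox 0 (b - a)"
        using cbox_translation[of a 0 "b - a"] by simp
      then have "h ` cbox a b = (+) (h a) ` h ` cbox 0 (b - a)"
        "measure lebesgue (cbox a b) = measure lebesgue (cbox 0 (b - a))"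
        "cbox 0 (b - a) \<noteq> {}"
        using ne by (simp_all add: measure_translation image_image linear_add[OF h] del: measure_completion)
      then show "measure lebesgue (h ` cbox a b) = measure lebesgue (cbox a b)"
        using measure_shear_interval[OF mn, of 0 "b - a"]
        by (simp only: measure_translation) (simp add: h_def[abs_def])
    qed
    then show "P (\<lambda>x. \<chi> i. if i = m then x $ m + x $ n else x $ i)"
      by (simp add: h_def[abs_def])
  qed
  with S show "f ` S \<in> lmeasurable" "measure lebesgue (f ` S) = \<bar>det (matrix f)\<bar> * measure lebesgue S"
    by (auto simp: P_def)
qed

section \<open>The shear that moves the apex from \<open>g\<close> to \<open>f\<close>\<close>

definition facet_shear :: "real^'n \<Rightarrow> real \<Rightarrow> real^'n \<Rightarrow> real^'n \<Rightarrow> real^'n \<Rightarrow> real^'n" where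
  "facet_shear a b g f x = x + ((b - a \<bullet> x) / (b - a \<bullet> g)) *\<^sub>R (f - g)"

text \<open>The linear part of \<open>facet_shear\<close>, put in rank-one form so that
  \<open>det_rank_one_update\<close> applies.\<close>

definition shear_linear :: "real^'n \<Rightarrow> real \<Rightarrow> real^'n \<Rightarrow> real^'n \<Rightarrow> real^'n \<Rightarrow> real^'n" where
  "shear_linear a b g f r = r + (a \<bullet> r) *\<^sub>R ((-1 / (b - a \<bullet> g)) *\<^sub>R (f - g))"

lemma linear_shear_linear: "linear (shear_linear a b g f)"
  unfolding shear_linear_def by (rule linear_rank_one_update)

lemma facet_shear_eq:
  assumes "a \<bullet> g < b"
  shows "facet_shear a b g f x = f + shear_linear a b g f (x - g)"
proof -
  have "(b - a \<bullet> x) / (b - a \<bullet> g) = 1 - a \<bullet> (x - g) / (b - a \<bullet> g)"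
    using assms by (simp add: field_simps inner_simps)
  moreover have "shear_linear a b g f (x - g) = (x - g) - (a \<bullet> (x - g) / (b - a \<bullet> g)) *\<^sub>R (f - g)"
    by (simp add: shear_linear_def)
  ultimately show ?thesis
    by (simp only: facet_shear_def scaleR_left_diff_distrib scaleR_one) (simp add: algebra_simps)
qed

lemma facet_shear_add_diff:
  assumes "a \<bullet> g < b"
  shows "facet_shear a b g f (x + r) = facet_shear a b g f x + shear_linear a b g f r"
    "facet_shear a b g f (x - r) = facet_shear a b g f x - shear_linear a b g f r"
  by (simp_all add: facet_shear_eq[OF assms] linear_add[OF linear_shear_linear] linear_diff[OF linear_shear_linear])

text \<open>The shear multiplies \<open>b - a \<bullet> x\<close> by
  \<open>(b - a \<bullet> f) / (b - a \<bullet> g)\<close>, so the reverse shear uses the same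
  coefficient \<open>t\<close> along \<open>g - f\<close> and undoes the displacement.\<close>

lemma facet_shear_inverse:
  assumes "a \<bullet> g < b" "a \<bullet> f < b"
  shows "facet_shear a b f g (facet_shear a b g f x) = x"
proof -
  define t where "t = (b - a \<bullet> x) / (b - a \<bullet> g)"
  have y: "facet_shear a b g f x = x + t *\<^sub>R (f - g)" by (simp add: facet_shear_def t_def)
  have "b - a \<bullet> (x + t *\<^sub>R (f - g)) = (b - a \<bullet> x) - t * (b - a \<bullet> g) + t * (b - a \<bullet> f)"
    by (simp add: inner_simps algebra_simps)
  also have "\<dots> = t * (b - a \<bullet> f)" using assms by (simp add: t_def)
  finally have "(b - a \<bullet> (x + t *\<^sub>R (f - g))) / (b - a \<bullet> f) = t" using assms by simp
  then show ?thesis unfolding y facet_shear_def[of a b f g] by (simp add: algebra_simps)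
qed

lemma facet_shear_translation:
  assumes "a \<bullet> w = 0"
  shows "facet_shear a b g f (x + w) = facet_shear a b g f x + w"
  using assms by (simp add: facet_shear_def inner_simps)

lemma inj_facet_shear:
  assumes "a \<bullet> g < b" "a \<bullet> f < b"
  shows "inj (facet_shear a b g f)"
  using facet_shear_inverse[OF assms] by (metis injI)

lemma facet_shear_image:
  assumes "a \<bullet> g < b"
  shows "facet_shear a b g f ` S = (+) f ` shear_linear a b g f ` (+) (-g) ` S"
  by (auto simp: image_image facet_shear_eq[OF assms])

lemma inj_shear_linear:
  assumes "a \<bullet> g < b" "a \<bullet> f < b"
  shows "inj (shear_linear a b g f)"
proof (rule injI)
  fix r s assume "shear_linear a b g f r = shear_linear a b g f s"
  then have "facet_shear a b g f (g + r) = facet_shear a b g f (g + s)"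
    by (simp add: facet_shear_eq[OF assms(1)])
  then show "r = s" using inj_facet_shear[OF assms] by (simp add: inj_eq)
qed

lemma interior_facet_shear:
  assumes "a \<bullet> g < b" "a \<bullet> f < b"
  shows "interior (facet_shear a b g f ` S) = facet_shear a b g f ` interior S"
  unfolding facet_shear_image[OF assms(1)] interior_translation
  by (simp only: interior_injective_linear_image[OF linear_shear_linear inj_shear_linear[OF assms]]
     interior_translation)

text \<open>The two strict inequalities make the determinant positive, so the absolute value
  disappears and the factor stays affine in \<open>f\<close>.\<close>

lemma measure_facet_shear:
  assumes "a \<bullet> g < b" "a \<bullet> f < b" "S \<in> lmeasurable"
  shows "facet_shear a b g f ` S \<in> lmeasurable"
    "measure lebesgue (facet_shear a b g f ` S) = (b - a \<bullet> f) / (b - a \<bullet> g) * measure lebesgue S"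
proof -
  have S: "(+) (-g) ` S \<in> lmeasurable" by (intro measurable_translation assms)
  note lin = lmeasurable_linear_image_cart[OF linear_shear_linear[of a b g f] S]
    measure_linear_image_cart[OF linear_shear_linear[of a b g f] S]
  have "det (matrix (shear_linear a b g f)) = 1 + a \<bullet> ((-1 / (b - a \<bullet> g)) *\<^sub>R (f - g))"
    unfolding shear_linear_def by (rule det_rank_one_update)
  also have "\<dots> = 1 - (a \<bullet> f - a \<bullet> g) / (b - a \<bullet> g)"
    by (simp add: inner_diff_right)
  also have "\<dots> = (b - a \<bullet> f) / (b - a \<bullet> g)"
    using assms by (simp add: divide_simps)
  finally have det: "\<bar>det (matrix (shear_linear a b g f))\<bar> = (b - a \<bullet> f) / (b - a \<bullet> g)"
    using assms by simp
  show "facet_shear a b g f ` S \<in> lmeasurable"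
    unfolding facet_shear_image[OF assms(1)] by (intro measurable_translation lin)
  show "measure lebesgue (facet_shear a b g f ` S) = (b - a \<bullet> f) / (b - a \<bullet> g) * measure lebesgue S"
    unfolding facet_shear_image[OF assms(1)] measure_translation lin det ..
qed

text \<open>Points of \<open>F\<close> are fixed by the affine shear while \<open>g\<close> goes to
  \<open>f\<close>, so its linear part sends each generator \<open>v - g\<close> to
  \<open>v - f\<close>; linear maps commute with conic hulls.\<close>

lemma facet_cone_shear:
  assumes F: "F \<subseteq> {x. a \<bullet> x = b}" and g: "a \<bullet> g < b"
  shows "facet_cone f F = shear_linear a b g f ` facet_cone g F"
proof -
  have "shear_linear a b g f (v - g) = v - f" if "v extreme_point_of F" for v
  proof -
    have "a \<bullet> (v - g) / (b - a \<bullet> g) = 1"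
      using that F g by (auto simp: extreme_point_of_def inner_simps)
    then show ?thesis by (simp add: shear_linear_def)
  qed
  then have "{v - f | v. v extreme_point_of F} = shear_linear a b g f ` {v - g | v. v extreme_point_of F}"
    by (auto simp: image_iff) metis+
  then show ?thesis
    unfolding facet_cone_def by (simp add: convex_cone_hull_linear_image[OF linear_shear_linear])
qed

text \<open>Both cones of a spindle are moved by the same linear part, with apexes \<open>g\<close>
  and \<open>y\<close> going to \<open>f\<close> and \<open>y\<close>. Injectivity carries this over
  to the intersection.\<close>

lemma spindle_shear:
  assumes F: "F \<subseteq> {x. a \<bullet> x = b}" and g: "a \<bullet> g < b" and f: "a \<bullet> f < b" and y: "y \<in> F"
  shows "spindle f F y = facet_shear a b g f ` spindle g F y"
proof -
  have ty: "facet_shear a b g f y = y" using F y by (auto simp: facet_shear_def)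
  have tg: "facet_shear a b g f g = f" using g by (auto simp: facet_shear_def)
  show ?thesis
    unfolding spindle_def image_Int[OF inj_facet_shear[OF g f]] facet_cone_shear[OF F g, of f]
    by (simp add: image_image facet_shear_add_diff[OF g] ty tg)
qed

subsection \<open>Overlaps of spindles modulo the integer lattice\<close>

lemma convex_facet_cone: "convex (facet_cone f F)"
  unfolding facet_cone_def by (rule convex_convex_cone_hull)

lemma facet_cone_subset_halfspace:
  assumes "\<And>v. v \<in> F \<Longrightarrow> n \<bullet> (v - f) \<le> 0"
  shows "facet_cone f F \<subseteq> {r. n \<bullet> r \<le> 0}"
  unfolding facet_cone_def
proof (rule hull_minimal)
  show "{v - f | v. v extreme_point_of F} \<subseteq> {r. n \<bullet> r \<le> 0}"
    using assms by (auto simp: extreme_point_of_def)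
qed (rule convex_cone_halfspace_le)

lemma spindle_alt:
  "spindle f F y = (+) f ` facet_cone f F \<inter> (+) y ` uminus ` facet_cone f F"
  by (simp add: spindle_def image_image)

lemma mem_uminus_image_iff: "x \<in> uminus ` S \<longleftrightarrow> - x \<in> S" for x :: "'a::group_add"
  by (auto intro: image_eqI[of _ _ "- x"])

lemma mem_interior_spindle_iff:
  "x \<in> interior (spindle f F y) \<longleftrightarrow> x - f \<in> interior (facet_cone f F) \<and> y - x \<in> interior (facet_cone f F)"
  by (simp only: spindle_alt interior_Int interior_translation interior_negations
      Int_iff mem_translation_iff mem_uminus_image_iff minus_diff_eq)

lemma convex_spindle: "convex (spindle f F y)"
  unfolding spindle_alt
  by (intro convex_Int convex_translation convex_negations convex_facet_cone)

section \<open>The gauge of a polyhedron through its facet normals\<close>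

locale facet_inequalities =
  fixes B :: "(real^'n) set" and a :: "(real^'n) set \<Rightarrow> real^'n" and b :: "(real^'n) set \<Rightarrow> real"
  assumes polyhedron: "polyhedron B"
    and normal_nonzero: "F facet_of B \<Longrightarrow> a F \<noteq> 0"
    and subset_halfspace: "F facet_of B \<Longrightarrow> B \<subseteq> {x. a F \<bullet> x \<le> b F}"
    and facet_eq: "F facet_of B \<Longrightarrow> F = B \<inter> {x. a F \<bullet> x = b F}"
begin

lemma interior_strict:
  assumes "F facet_of B" "f \<in> interior B"
  shows "a F \<bullet> f < b F"
  using interior_mono[OF subset_halfspace[OF assms(1)]] assms(2)
    interior_halfspace_le[OF normal_nonzero[OF assms(1)]] by blast

text \<open>The facet normal rescaled so that the inequality of \<open>F\<close> has right-hand side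
  1 in terms of \<open>x - f\<close>. For bounded \<open>B\<close>, the maximum of these functionals
  over all facets is the gauge of \<open>B - f\<close>.\<close>

definition normal :: "real^'n \<Rightarrow> (real^'n) set \<Rightarrow> real^'n" where
  "normal f F = (1 / (b F - a F \<bullet> f)) *\<^sub>R a F"

lemma normal_le_iff:
  assumes "F facet_of B" "f \<in> interior B"
  shows "normal f F \<bullet> (x - f) \<le> 1 \<longleftrightarrow> a F \<bullet> x \<le> b F"
    and "normal f F \<bullet> (x - f) = 1 \<longleftrightarrow> a F \<bullet> x = b F"
  using interior_strict[OF assms] by (auto simp: normal_def inner_diff_right divide_simps)

lemma normal_inj:
  assumes "F facet_of B" "G facet_of B" "f \<in> interior B" "normal f F = normal f G"
  shows "F = G"
proof -
  have "a F \<bullet> x = b F \<longleftrightarrow> a G \<bullet> x = b G" for x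
    using normal_le_iff(2)[OF assms(1,3), of x] normal_le_iff(2)[OF assms(2,3), of x] assms(4) by metis
  then have "B \<inter> {x. a F \<bullet> x = b F} = B \<inter> {x. a G \<bullet> x = b G}" by blast
  then show ?thesis using facet_eq[OF assms(1)] facet_eq[OF assms(2)] by argo
qed

text \<open>The segment from \<open>f\<close> to \<open>p\<close> leaves the interior at a point
  \<open>q\<close> of some facet \<open>G\<close>. The functional of \<open>G\<close> is 1 at
  \<open>q - f\<close>, and \<open>p - f\<close> is at least as long in the same direction.\<close>

lemma exists_violated_facet:
  assumes f: "f \<in> interior B" and p: "p \<notin> interior B"
  obtains G where "G facet_of B" "1 \<le> normal f G \<bullet> (p - f)"
proof -
  have "closed_segment f p \<inter> frontier (interior B) \<noteq> {}"
    using f p by (intro connected_Int_frontier) auto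
  then obtain q where q: "q \<in> closed_segment f p" "q \<in> frontier (interior B)" by blast
  then have "q \<in> frontier B" using frontier_interior_subset by blast
  then have "q \<in> rel_frontier B" using f rel_frontier_nonempty_interior by blast
  then obtain G where G: "G facet_of B" "q \<in> G"
    using rel_frontier_of_polyhedron[OF polyhedron] by auto
  obtain t where t: "0 \<le> t" "t \<le> 1" "q - f = t *\<^sub>R (p - f)"
    using q(1) by (auto simp: in_segment algebra_simps)
  have "normal f G \<bullet> (q - f) = 1"
    using normal_le_iff(2)[OF G(1) f] facet_eq[OF G(1)] G(2) by blast
  then have "t * (normal f G \<bullet> (p - f)) = 1" using t(3) by simp
  moreover from this have "0 \<le> normal f G \<bullet> (p - f)"
    using t(1) by (metis zero_le_mult_iff zero_le_one linorder_linear mult_eq_0_iff zero_neq_one antisym)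
  ultimately have "1 \<le> normal f G \<bullet> (p - f)"
    using t(2) mult_left_le_one_le[of "normal f G \<bullet> (p - f)" t] t(1) by simp
  with G(1) show thesis by (rule that)
qed

text \<open>On \<open>F\<close> the functional of \<open>F\<close> equals 1 and that of
  \<open>G\<close> is at most 1, so the comparison holds for the generators and hence on the
  cone.\<close>

lemma facet_cone_normal_le:
  assumes "F facet_of B" "G facet_of B" "f \<in> interior B"
  shows "facet_cone f F \<subseteq> {r. (normal f G - normal f F) \<bullet> r \<le> 0}"
proof (rule facet_cone_subset_halfspace)
  fix v assume "v \<in> F"
  then have "v \<in> B" "a F \<bullet> v = b F" using facet_eq[OF assms(1)] by blast+
  then have "normal f F \<bullet> (v - f) = 1" "normal f G \<bullet> (v - f) \<le> 1"
    using normal_le_iff[OF assms(1,3)] normal_le_iff[OF assms(2,3)] subset_halfspace[OF assms(2)] by auto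
  then show "(normal f G - normal f F) \<bullet> (v - f) \<le> 0" by (simp add: inner_diff_left)
qed

text \<open>Distinct facets have distinct normals, and a nonzero functional that is nonpositive on a
  set is negative on its interior.\<close>

lemma interior_facet_cone_normal_less:
  assumes "F facet_of B" "G facet_of B" "f \<in> interior B" "G \<noteq> F" "r \<in> interior (facet_cone f F)"
  shows "normal f G \<bullet> r < normal f F \<bullet> r"
proof -
  have "normal f G - normal f F \<noteq> 0" using normal_inj assms by auto
  then have "r \<in> {r. (normal f G - normal f F) \<bullet> r < 0}"
    using interior_mono[OF facet_cone_normal_le[OF assms(1,2,3)]] assms(5) interior_halfspace_le by blast
  then show ?thesis by (simp add: inner_diff_left)
qed

text \<open>If \<^term>\<open>x\<close> and \<^term>\<open>x'\<close> agree modulo the lattice, then \<^term>\<open>x' + (y - x)\<close> is a lattice point,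
  hence not interior to \<^term>\<open>B\<close>; so the gauge of \<^term>\<open>x' - f\<close> is at least that of \<^term>\<open>x - f\<close>.\<close>

lemma spindle_overlap_aux:
  assumes free: "interior B \<inter> integer_lattice = {}" and f: "f \<in> interior B"
    and F: "F facet_of B" and G: "G facet_of B" and y: "y \<in> F \<inter> integer_lattice"
    and x: "x \<in> interior (spindle f F y)" and x': "x' \<in> interior (spindle f G y')"
    and xx': "x - x' \<in> integer_lattice"
  shows "normal f F \<bullet> (x - f) < normal f G \<bullet> (x' - f) \<or>
    normal f F \<bullet> (x - f) = normal f G \<bullet> (x' - f) \<and> F = G"
proof -
  have x1: "y - x \<in> interior (facet_cone f F)" using x by (simp add: mem_interior_spindle_iff)
  have x2: "x' - f \<in> interior (facet_cone f G)" using x' by (simp add: mem_interior_spindle_iff)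
  have "x' + (y - x) \<in> integer_lattice"
    using integer_lattice_diff[of y "x - x'"] y xx' by (simp add: algebra_simps)
  then have "x' + (y - x) \<notin> interior B" using free by blast
  then obtain H where H: "H facet_of B" "1 \<le> normal f H \<bullet> (x' + (y - x) - f)"
    using exists_violated_facet[OF f] by blast
  have "normal f F \<bullet> (y - f) = 1"
    using y facet_eq[OF F] normal_le_iff(2)[OF F f] by blast
  then have H2: "normal f F \<bullet> (x - f) + normal f F \<bullet> (y - x) \<le> normal f H \<bullet> (x' - f) + normal f H \<bullet> (y - x)"
    using H(2) by (simp add: inner_diff_right inner_add_right)
  \<comment> \<open>The vector \<open>x' - f\<close> lies in the cone over \<open>G\<close> and
    \<open>y - x\<close> in the cone over \<open>F\<close>; there \<open>G\<close> and
    \<open>F\<close> respectively dominate \<open>H\<close>.\<close>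
  have le: "normal f H \<bullet> (x' - f) \<le> normal f G \<bullet> (x' - f)" "normal f H \<bullet> (y - x) \<le> normal f F \<bullet> (y - x)"
    using facet_cone_normal_le[OF G H(1) f] x2 facet_cone_normal_le[OF F H(1) f] x1 interior_subset
    by (fastforce simp: inner_diff_left)+
  show ?thesis
  proof (cases "normal f F \<bullet> (x - f) < normal f G \<bullet> (x' - f)")
    case False
    \<comment> \<open>Without strict inequality both estimates in \<open>le\<close> must be
      equalities, which strict domination on the cone interiors permits only if \<open>H\<close> is
      both facets.\<close>
    then have "H = G" "H = F"
      using le H2 interior_facet_cone_normal_less[OF G H(1) f _ x2]
        interior_facet_cone_normal_less[OF F H(1) f _ x1] by fastforce+
    then show ?thesis using False H2 by auto
  qed simp
qed

text \<open>Apply \<open>spindle_overlap_aux\<close> in both directions: the strict alternatives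
  exclude each other, so the two gauge values coincide and the facets agree.\<close>

lemma spindle_overlap:
  assumes free: "interior B \<inter> integer_lattice = {}" and f: "f \<in> interior B"
    and F: "F facet_of B" and G: "G facet_of B"
    and y: "y \<in> F \<inter> integer_lattice" and y': "y' \<in> G \<inter> integer_lattice"
    and x: "x \<in> interior (spindle f F y)" and x': "x' \<in> interior (spindle f G y')"
    and xx': "x - x' \<in> integer_lattice"
  shows "F = G" "a F \<bullet> (x - x') = 0"
proof -
  have x'x: "x' - x \<in> integer_lattice" using integer_lattice_minus[OF xx'] by simp
  have *: "normal f F \<bullet> (x - f) = normal f G \<bullet> (x' - f) \<and> F = G"
    using spindle_overlap_aux[OF free f F G y x x' xx'] spindle_overlap_aux[OF free f G F y' x' x x'x]
    by argo
  then show "F = G" ..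
  have "normal f F \<bullet> (x - x') = 0" using * inner_diff_right[of "normal f F"] by (smt (verit, best))
  then show "a F \<bullet> (x - x') = 0"
    using interior_strict[OF F f] by (simp add: normal_def)
qed

end

section \<open>Transport of the transversals and summation over the facets\<close>

theorem theorem4:
  fixes B :: "(real^'n) set"
  assumes "maximal_lattice_free B" and "simplicial_polytope B"
  shows "\<exists>(a::real^'n) (b::real). \<forall>f\<in>interior B.
           measure torus (torus_proj ` lifting_region B f) = a \<bullet> f + b"
proof -
  have poly: "polyhedron B" and "interior B \<noteq> {}"
    using assms(2) by (auto simp: simplicial_polytope_def polytope_imp_polyhedron)
  then obtain g where g: "g \<in> interior B" by blast
  have free: "interior B \<inter> integer_lattice = {}"
    using assms(1) by (simp add: maximal_lattice_free_def lattice_free_def)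
  have "\<exists>c d. F facet_of B \<longrightarrow> c \<noteq> 0 \<and> B \<subseteq> {x. c \<bullet> x \<le> d} \<and> F = B \<inter> {x. c \<bullet> x = d}" for F
    using facet_of_polyhedron[OF poly] by metis
  then obtain a b where ab:
    "\<And>F. F facet_of B \<longrightarrow> a F \<noteq> 0 \<and> B \<subseteq> {x. a F \<bullet> x \<le> b F} \<and> F = B \<inter> {x. a F \<bullet> x = b F}"
    by metis
  interpret facet_inequalities B a b
    by unfold_locales (use poly ab in blast)+
  \<comment> \<open>Interiors make the union open, hence measurable, and are what
    \<open>spindle_overlap\<close> speaks about; the frontiers go into a null set later.\<close>
  define V where "V F = (\<Union>y\<in>F \<inter> integer_lattice. interior (spindle g F y))" for F :: "(real^'n) set"
  define L where "L F = {w \<in> integer_lattice. a F \<bullet> w = 0}" for F :: "(real^'n) set"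
  have "\<exists>D. D \<subseteq> V F \<and> D \<in> sets lebesgue \<and> (\<forall>x\<in>V F. \<exists>d\<in>D. x - d \<in> L F) \<and>
      (\<forall>d\<in>D. \<forall>d'\<in>D. d - d' \<in> L F \<longrightarrow> d = d')" for F
  proof -
    have "open (V F)" unfolding V_def by blast
    then have "V F \<in> sets lebesgue" by (simp add: borel_open)
    moreover have "L F \<subseteq> integer_lattice" "0 \<in> L F" "\<And>z. z \<in> L F \<Longrightarrow> - z \<in> L F"
      "\<And>z w. z \<in> L F \<Longrightarrow> w \<in> L F \<Longrightarrow> z + w \<in> L F"
      by (auto simp: L_def integer_lattice_0 integer_lattice_minus integer_lattice_add inner_add_right)
    ultimately obtain D where "D \<subseteq> V F" "D \<in> sets lebesgue" "\<forall>x\<in>V F. \<exists>d\<in>D. x - d \<in> L F"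
        "\<forall>d\<in>D. \<forall>d'\<in>D. d - d' \<in> L F \<longrightarrow> d = d'"
      by (rule measurable_transversal)
    then show ?thesis by (intro exI conjI)
  qed
  then obtain D where D: "\<And>F. D F \<subseteq> V F" "\<And>F. D F \<in> sets lebesgue"
      "\<And>F x. x \<in> V F \<Longrightarrow> \<exists>d\<in>D F. x - d \<in> L F"
      "\<And>F d d'. d \<in> D F \<Longrightarrow> d' \<in> D F \<Longrightarrow> d - d' \<in> L F \<Longrightarrow> d = d'"
    by metis
  \<comment> \<open>Congruent points of \<open>D F\<close> differ by an element of
    \<open>L F\<close>, hence coincide; so \<open>D F\<close> injects into the torus and has finite
    measure.\<close>
  have Dm: "D F \<in> lmeasurable" if F: "F facet_of B" for F
  proof (rule lmeasurable_if_inj_on_torus_proj[OF D(2)], rule inj_onI)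
    fix x x' assume x: "x \<in> D F" "x' \<in> D F" "torus_proj x = torus_proj x'"
    obtain y y' where "y \<in> F \<inter> integer_lattice" "x \<in> interior (spindle g F y)"
      "y' \<in> F \<inter> integer_lattice" "x' \<in> interior (spindle g F y')"
      using x(1,2) D(1)[of F] unfolding V_def by blast
    then have "x - x' \<in> L F"
      using spindle_overlap(2)[OF free g F F] x(3) by (auto simp: L_def torus_proj_eq_iff)
    then show "x = x'" using D(4) x by blast
  qed
  \<comment> \<open>The transversals are chosen at the fixed point \<open>g\<close>, so
    \<open>m F\<close> does not depend on \<open>f\<close>.\<close>
  define m where "m F = measure lebesgue (D F) / (b F - a F \<bullet> g)" for F
  have main: "measure torus (torus_proj ` lifting_region B f) = (\<Sum>F | F facet_of B. (b F - a F \<bullet> f) * m F)"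
    if f: "f \<in> interior B" for f
  proof -
    define T where "T F = facet_shear (a F) (b F) g f" for F
    define E where "E F = (+) (-f) ` T F ` D F" for F
    have spindle_T: "interior (spindle f F y) = T F ` interior (spindle g F y)" if "F facet_of B" "y \<in> F" for F y
    proof -
      note st = interior_strict[OF that(1) g] interior_strict[OF that(1) f]
      have "F \<subseteq> {x. a F \<bullet> x = b F}" using facet_eq[OF that(1)] by blast
      then have "spindle f F y = T F ` spindle g F y"
        unfolding T_def using st that(2) by (rule spindle_shear)
      then show ?thesis by (simp add: T_def interior_facet_shear[OF st])
    qed
    have in_spindle: "\<exists>y\<in>F \<inter> integer_lattice. T F d \<in> interior (spindle f F y)"
      if "F facet_of B" "d \<in> D F" for F d
    proof -
      from that(2) D(1) obtain y where y: "y \<in> F \<inter> integer_lattice" "d \<in> interior (spindle g F y)"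
        unfolding V_def by blast
      then have "T F d \<in> interior (spindle f F y)" using spindle_T[OF that(1), of y] by blast
      with y show ?thesis by blast
    qed
    have overlap: "F = G \<and> d = d'"
      if F: "F facet_of B" and G: "G facet_of B" and d: "d \<in> D F" "d' \<in> D G" "T F d - T G d' \<in> integer_lattice"
      for F G d d'
    proof -
      obtain y y' where y: "y \<in> F \<inter> integer_lattice" "y' \<in> G \<inter> integer_lattice"
        "T F d \<in> interior (spindle f F y)" "T G d' \<in> interior (spindle f G y')"
        using in_spindle[OF F d(1)] in_spindle[OF G d(2)] by blast
      note ov = spindle_overlap[OF free f F G y d(3)]
      \<comment> \<open>Since \<open>F = G\<close>, this is the given lattice difference. It is
        parallel to \<open>F\<close>, so the shear commutes with translation by \<open>w\<close> and
        the relation pulls back to \<open>d\<close> and \<open>d'\<close>.\<close>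
      define w where "w = T F d - T F d'"
      have w: "w \<in> integer_lattice" "a F \<bullet> w = 0" using d(3) ov by (auto simp: w_def)
      have "T F (d' + w) = T F d" unfolding T_def facet_shear_translation[OF w(2)] by (simp add: w_def T_def)
      then have "d' + w = d"
        using inj_facet_shear[OF interior_strict[OF F g] interior_strict[OF F f]] by (simp add: T_def inj_eq)
      then have "d - d' \<in> L F" using w by (auto simp: L_def)
      then show ?thesis using D(4) d ov(1) by blast
    qed
    have Em: "E F \<in> lmeasurable" "measure lebesgue (E F) = (b F - a F \<bullet> f) * m F" if F: "F facet_of B" for F
      using measure_facet_shear[OF interior_strict[OF F g] interior_strict[OF F f] Dm[OF F]]
      by (simp_all add: E_def T_def m_def measurable_translation_subtract measure_translation_subtract)
    have fin: "finite {F. F facet_of B}" using finite_polyhedron_facets[OF poly] .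
    have "measure torus (torus_proj ` lifting_region B f) = measure lebesgue (\<Union>F\<in>{F. F facet_of B}. E F)"
    proof (rule measure_torus_proj_transversal)
      show "(\<Union>F\<in>{F. F facet_of B}. E F) \<in> sets lebesgue"
        using fin Em(1) by (intro sets.finite_UN) (auto intro: fmeasurableD)
      show "inj_on torus_proj (\<Union>F\<in>{F. F facet_of B}. E F)"
      proof (rule inj_onI)
        fix p q assume "p \<in> (\<Union>F\<in>{F. F facet_of B}. E F)" "q \<in> (\<Union>F\<in>{F. F facet_of B}. E F)"
          and pq: "torus_proj p = torus_proj q"
        then obtain F G d d' where *: "F facet_of B" "G facet_of B" "d \<in> D F" "d' \<in> D G"
          "p = - f + T F d" "q = - f + T G d'"
          unfolding E_def by blast
        then show "p = q" using pq overlap[OF *(1-4)] by (auto simp: torus_proj_eq_iff)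
      qed
      show "(\<Union>F\<in>{F. F facet_of B}. E F) \<subseteq> lifting_region B f"
      proof
        fix p assume "p \<in> (\<Union>F\<in>{F. F facet_of B}. E F)"
        then obtain F d where *: "F facet_of B" "d \<in> D F" "p = T F d - f"
          unfolding E_def by auto
        then show "p \<in> lifting_region B f"
          using in_spindle[OF *(1,2)] interior_subset unfolding lifting_region_def by blast
      qed
      \<comment> \<open>Spindles are convex, so their frontiers are null sets, and only countably
        many of them occur.\<close>
      show "negligible (\<Union>F\<in>{F. F facet_of B}. \<Union>y\<in>F \<inter> integer_lattice. (+) (-f) ` frontier (spindle f F y))"
        using fin countable_subset[OF Int_lower2 countable_integer_lattice]
        by (intro negligible_countable_Union countable_image)
          (auto intro!: negligible_countable_Union countable_image
            negligible_translation[of _ "- f", simplified] negligible_convex_frontier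
            convex_spindle simp: countable_finite)
      fix p assume "p \<in> lifting_region B f"
      then obtain F y x where x: "F facet_of B" "y \<in> F \<inter> integer_lattice" "x \<in> spindle f F y" "p = x - f"
        unfolding lifting_region_def by blast
      show "p \<in> (\<Union>F\<in>{F. F facet_of B}. \<Union>y\<in>F \<inter> integer_lattice. (+) (-f) ` frontier (spindle f F y)) \<or>
          (\<exists>e\<in>(\<Union>F\<in>{F. F facet_of B}. E F). p - e \<in> integer_lattice)"
      proof (cases "x \<in> interior (spindle f F y)")
        case True
        then obtain z where z: "z \<in> interior (spindle g F y)" "x = T F z"
          using spindle_T[OF x(1)] x(2) by blast
        \<comment> \<open>Pull \<open>x\<close> back to \<open>z\<close> over \<open>g\<close> and
          pass to its representative \<open>d\<close>; the difference lies in \<open>L F\<close>, so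
          \<open>T F\<close> leaves it unchanged.\<close>
        then obtain d where d: "d \<in> D F" "z - d \<in> L F" using D(3) x(2) unfolding V_def by blast
        have "T F (d + (z - d)) = T F d + (z - d)"
          unfolding T_def by (rule facet_shear_translation) (use d(2) in \<open>auto simp: L_def\<close>)
        then have "p - (- f + T F d) = z - d" using x(4) z(2) by (simp add: algebra_simps)
        then have "p - (- f + T F d) \<in> integer_lattice" using d(2) by (simp add: L_def)
        moreover have "- f + T F d \<in> E F" unfolding E_def using d(1) by blast
        ultimately show ?thesis using x(1) by blast
      next
        case False
        then have "x \<in> frontier (spindle f F y)" using x(3) closure_subset by (auto simp: frontier_def)
        moreover have "p = - f + x" using x(4) by simp
        ultimately show ?thesis using x(1,2) by blast
      qed
    qed
    also have "\<dots> = (\<Sum>F | F facet_of B. measure lebesgue (E F))"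
    proof (rule measure_finite_Union[OF fin])
      show "disjoint_family_on E {F. F facet_of B}"
        unfolding disjoint_family_on_def
      proof (intro ballI impI)
        fix F G assume FG: "F \<in> {F. F facet_of B}" "G \<in> {F. F facet_of B}" "F \<noteq> G"
        have False if "p \<in> E F" "p \<in> E G" for p
        proof -
          from that obtain d d' where "d \<in> D F" "d' \<in> D G" "- f + T F d = - f + T G d'"
            unfolding E_def by blast
          then show False using overlap[of F G d d'] FG by (simp add: integer_lattice_0)
        qed
        then show "E F \<inter> E G = {}" by blast
      qed
      show "E ` {F. F facet_of B} \<subseteq> sets lebesgue" using Em(1) fmeasurableD by blast
      show "emeasure lebesgue (E F) \<noteq> \<infinity>" if "F \<in> {F. F facet_of B}" for F
        using Em(1)[of F] that fmeasurableD2 by fastforce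
    qed
    also have "\<dots> = (\<Sum>F | F facet_of B. (b F - a F \<bullet> f) * m F)"
      using Em(2) by (intro sum.cong) auto
    finally show ?thesis .
  qed
  show ?thesis
  proof (intro exI ballI)
    fix f assume "f \<in> interior B"
    then show "measure torus (torus_proj ` lifting_region B f)
      = (\<Sum>F | F facet_of B. (- m F) *\<^sub>R a F) \<bullet> f + (\<Sum>F | F facet_of B. b F * m F)"
      by (simp add: main inner_sum_left sum.distrib[symmetric] algebra_simps)
  qed
qed

end
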